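(* Let $w_{ij}\ge 0$, let $\mathcal{B}_{ij}\subseteq\mathbb{R}^3$ be the polytope given by the bounds in the context, and let $$\mathcal{X}_{ij} := \{(f_{ij}, \pi_{i}, \pi_{j}) \in \mathcal{B}_{ij}: \pi_{i} - \pi_{j} = w_{ij} |f_{ij}|f_{ij} \}$$ be the Weymouth set. Then $\mathrm{conv}(\mathcal{X}_{ij})$ is second-order cone representable (SOCr).
   Context: Data: real numbers $0\le\underline{\pi}_i\le\bar{\pi}_i$, $0\le\underline{\pi}_j\le\bar{\pi}_j$, flow bounds $\underline{f}_{ij}\le \bar f_{ij}$ and a coefficient $w_{ij}\ge 0$. Set $$\underline{\alpha}_{ij} := \max\Big\{\underline{f}_{ij}, -\sqrt{(\bar{\pi}_{j} - \underline{\pi}_i)/w_{ij}}\Big\},\quad \bar{\alpha}_{ij} := \min\Big\{\bar{f}_{ij}, \sqrt{(\bar{\pi}_{i} - \underline{\pi}_j)/w_{ij}}\Big\},$$ $$\underline{\beta}_{ij} := \max\{-w_{ij}\underline{f}_{ij}^2, \underline{\pi}_{i} - \bar{\pi}_j\},\quad \bar{\beta}_{ij} := \min\{w_{ij}\bar{f}_{ij}^2, \bar{\pi}_{i} - \underline{\pi}_j\}$$ (if $w_{ij}=0$, then $\underline{\alpha}_{ij}:=\underline f_{ij}$ and $\bar\alpha_{ij}:=\bar f_{ij}$). Standing assumption: $\underline{\alpha}_{ij}\le 0\le\bar{\alpha}_{ij}$ and $\underline{\beta}_{ij}\le 0\le\bar{\beta}_{ij}$ (in particular $\underline\pi_i\le\bar\pi_j$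 and $\underline\pi_j\le\bar\pi_i$). Define $$\mathcal{B}_{ij} := \{(f_{ij}, \pi_i, \pi_j) \in \mathbb{R}^3 : \underline{\alpha}_{ij} \le f_{ij} \le \bar{\alpha}_{ij},\ \underline{\beta}_{ij} \le \pi_i - \pi_j \le \bar{\beta}_{ij},\ \underline{\pi}_{i} \le \pi_i \le \bar{\pi}_{i},\ \underline{\pi}_{j} \le \pi_j \le \bar{\pi}_{j}\}.$$ A convex set $Y\subseteq\mathbb{R}^n$ is second-order cone representable (SOCr) if there are $m$, an affine map $T$ and a cone $K$ that is a finite product of second-order (Lorentz) cones such that $Y=\{x\in\mathbb{R}^n:\exists w\in\mathbb{R}^m,\ T(x,w)\in K\}$. $\mathrm{conv}$ denotes convex hull. *)

theory Defs
  imports "HOL-Analysis.Analysis"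
begin

text \<open>The Lorentz cone of dimension \<open>Suc d\<close>: the vector is \<open>(y 0, y 1, \<dots>, y d)\<close>, with the bounding
  coordinate first. Coordinates beyond \<open>d\<close> are irrelevant.\<close>

definition lorentz_cone :: "nat \<Rightarrow> (nat \<Rightarrow> real) set" where
  "lorentz_cone d = {y. L2_set y {1..d} \<le> y 0}"

text \<open>The image space is the product of \<open>q\<close> blocks, block \<open>k\<close> having dimension \<open>Suc (d k)\<close>, so a
  point of it is a doubly indexed family. An affine map into it is given by its coefficients: entry
  \<open>(k, i)\<close> of \<open>T(x, v)\<close> is \<open>a k i \<bullet> x + (\<Sum>l<m. B k i l * v l) + c k i\<close>, where \<open>v 0, \<dots>, v (m - 1)\<close>
  are the coordinates of the auxiliary vector in dimension \<open>m\<close>.\<close>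

definition affine_map ::
    "nat \<Rightarrow> (nat \<Rightarrow> nat \<Rightarrow> 'a::euclidean_space) \<Rightarrow> (nat \<Rightarrow> nat \<Rightarrow> nat \<Rightarrow> real) \<Rightarrow> (nat \<Rightarrow> nat \<Rightarrow> real)
      \<Rightarrow> 'a \<Rightarrow> (nat \<Rightarrow> real) \<Rightarrow> nat \<Rightarrow> nat \<Rightarrow> real" where
  "affine_map m a B c x v = (\<lambda>k i. a k i \<bullet> x + (\<Sum>l<m. B k i l * v l) + c k i)"

definition SOCr :: "'a::euclidean_space set \<Rightarrow> bool" where
  "SOCr Y \<longleftrightarrow> convex Y \<and>
     (\<exists>m q d a B c. Y = {x. \<exists>v. affine_map m a B c x v \<in> (\<Pi> k\<in>{..<q}. lorentz_cone (d k))})"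

text \<open>Below, \<open>fl \<le> fu\<close> are the flow bounds, \<open>pil \<le> piu\<close> and \<open>pjl \<le> pju\<close> the bounds on the squared
  pressures at the two ends \<open>i\<close> and \<open>j\<close> of the pipe, and \<open>w\<close> is the Weymouth coefficient.\<close>

definition alpha_lo :: "real \<Rightarrow> real \<Rightarrow> real \<Rightarrow> real \<Rightarrow> real" where
  "alpha_lo w fl pil pju = (if w = 0 then fl else max fl (- sqrt ((pju - pil) / w)))"

definition alpha_up :: "real \<Rightarrow> real \<Rightarrow> real \<Rightarrow> real \<Rightarrow> real" where
  "alpha_up w fu piu pjl = (if w = 0 then fu else min fu (sqrt ((piu - pjl) / w)))"

definition beta_lo :: "real \<Rightarrow> real \<Rightarrow> real \<Rightarrow> real \<Rightarrow> real" where
  "beta_lo w fl pil pju = max (- w * fl\<^sup>2) (pil - pju)"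

definition beta_up :: "real \<Rightarrow> real \<Rightarrow> real \<Rightarrow> real \<Rightarrow> real" where
  "beta_up w fu piu pjl = min (w * fu\<^sup>2) (piu - pjl)"

definition bound_set ::
    "real \<Rightarrow> real \<Rightarrow> real \<Rightarrow> real \<Rightarrow> real \<Rightarrow> real \<Rightarrow> real \<Rightarrow> (real \<times> real \<times> real) set" where
  "bound_set w fl fu pil piu pjl pju =
     {(f, p\<^sub>i, p\<^sub>j).
        alpha_lo w fl pil pju \<le> f \<and> f \<le> alpha_up w fu piu pjl \<and>
        beta_lo w fl pil pju \<le> p\<^sub>i - p\<^sub>j \<and> p\<^sub>i - p\<^sub>j \<le> beta_up w fu piu pjl \<and>
        pil \<le> p\<^sub>i \<and> p\<^sub>i \<le> piu \<and> pjl \<le> p\<^sub>j \<and> p\<^sub>j \<le> pju}"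

definition weymouth_set ::
    "real \<Rightarrow> real \<Rightarrow> real \<Rightarrow> real \<Rightarrow> real \<Rightarrow> real \<Rightarrow> real \<Rightarrow> (real \<times> real \<times> real) set" where
  "weymouth_set w fl fu pil piu pjl pju =
     {(f, p\<^sub>i, p\<^sub>j). (f, p\<^sub>i, p\<^sub>j) \<in> bound_set w fl fu pil piu pjl pju \<and> p\<^sub>i - p\<^sub>j = w * \<bar>f\<bar> * f}"

end

(* Along the direction (0, 1, 1) the Weymouth equation is invariant, so every point of the Weymouth
   set lies on a segment whose endpoints satisfy one of the four pressure bounds with equality.
   Splitting by the sign of the flow f, the points with such an active bound form eight arcs
   c + t u + t^2 v with t in a compact interval. The hull of one arc over [a, b] is given by t^2 <= r
   and r <= (a + b) t - a b, the chord bound; homogenising this description with multipliers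
   turns the hull of the union of the arcs into the projection of a system of second-order cone
   constraints. *)
theory Submission
  imports Defs
begin

section \<open>Systems of second-order cone constraints\<close>

text \<open>The coefficients sit behind an existential so that affinity follows from syntactic
  closure rules, without naming them.\<close>

definition affine_fun :: "nat \<Rightarrow> ('a::euclidean_space \<Rightarrow> (nat \<Rightarrow> real) \<Rightarrow> real) \<Rightarrow> bool" where
  "affine_fun m g \<longleftrightarrow> (\<exists>a b c. \<forall>x v. g x v = a \<bullet> x + (\<Sum>l<m. b l * v l) + c)"

text \<open>Stated for predicates rather than sets, so that constraints can be conjoined while
  sharing the same \<open>m\<close> auxiliary coordinates.\<close>

definition soc_system :: "nat \<Rightarrow> ('a::euclidean_space \<Rightarrow> (nat \<Rightarrow> real) \<Rightarrow> bool) \<Rightarrow> bool" where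
  "soc_system m P \<longleftrightarrow>
     (\<exists>q d a B c. \<forall>x v. P x v \<longleftrightarrow> (\<forall>k<q. affine_map m a B c x v k \<in> lorentz_cone (d k)))"

section \<open>Closure rules for affine functions\<close>

lemma affine_fun_const: "affine_fun m (\<lambda>x v. c)"
  unfolding affine_fun_def by (intro exI[of _ 0] exI[of _ "\<lambda>_. 0"] exI[of _ c]) simp

lemma affine_fun_inner: "affine_fun m (\<lambda>x v. x \<bullet> b)"
  unfolding affine_fun_def
  by (intro exI[of _ b] exI[of _ "\<lambda>_. 0"] exI[of _ 0]) (simp add: inner_commute)

lemma affine_fun_coord:
  assumes "l < m"
  shows "affine_fun m (\<lambda>x v. v l)"
proof -
  have "(\<Sum>i<m. (if i = l then 1 else 0) * v i) = v l" for v :: "nat \<Rightarrow> real"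
    using assms by (simp add: if_distrib[of "\<lambda>y. y * _"] cong: if_cong)
  then show ?thesis
    unfolding affine_fun_def
    by (intro exI[of _ 0] exI[of _ "\<lambda>i. if i = l then 1 else 0"] exI[of _ 0]) simp
qed

lemma affine_fun_add:
  assumes "affine_fun m g" "affine_fun m h"
  shows "affine_fun m (\<lambda>x v. g x v + h x v)"
proof -
  obtain a b c a' b' c' where
    "\<And>x v. g x v = a \<bullet> x + (\<Sum>l<m. b l * v l) + c"
    "\<And>x v. h x v = a' \<bullet> x + (\<Sum>l<m. b' l * v l) + c'"
    using assms unfolding affine_fun_def by metis
  then show ?thesis
    unfolding affine_fun_def
    by (intro exI[of _ "a + a'"] exI[of _ "\<lambda>l. b l + b' l"] exI[of _ "c + c'"])
      (simp add: inner_add_left sum.distrib distrib_right)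
qed

lemma affine_fun_cmult:
  assumes "affine_fun m g"
  shows "affine_fun m (\<lambda>x v. s * g x v)"
proof -
  obtain a b c where "\<And>x v. g x v = a \<bullet> x + (\<Sum>l<m. b l * v l) + c"
    using assms unfolding affine_fun_def by metis
  then show ?thesis
    unfolding affine_fun_def
    by (intro exI[of _ "s *\<^sub>R a"] exI[of _ "\<lambda>l. s * b l"] exI[of _ "s * c"])
      (simp add: sum_distrib_left distrib_left mult.assoc)
qed

lemma affine_fun_multc: "affine_fun m g \<Longrightarrow> affine_fun m (\<lambda>x v. g x v * s)"
  using affine_fun_cmult[of m g s] by (simp add: mult.commute)

lemma affine_fun_diff:
  "affine_fun m g \<Longrightarrow> affine_fun m h \<Longrightarrow> affine_fun m (\<lambda>x v. g x v - h x v)"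
  using affine_fun_add[of m g "\<lambda>x v. (-1) * h x v"] affine_fun_cmult[of m h "-1"] by simp

lemma affine_fun_sum:
  "(\<And>k. k \<in> K \<Longrightarrow> affine_fun m (g k)) \<Longrightarrow> affine_fun m (\<lambda>x v. \<Sum>k\<in>K. g k x v)"
  by (induction K rule: infinite_finite_induct) (simp_all add: affine_fun_const affine_fun_add)

lemmas affine_fun_intros =
  affine_fun_const affine_fun_inner affine_fun_coord affine_fun_add affine_fun_diff
  affine_fun_cmult affine_fun_multc affine_fun_sum

section \<open>Closure rules for conic systems\<close>

lemma soc_system_lorentz:
  assumes "\<And>i. affine_fun m (g i)"
  shows "soc_system m (\<lambda>x v. (\<lambda>i. g i x v) \<in> lorentz_cone d)"
proof -
  obtain a b c where "\<And>i x v. g i x v = a i \<bullet> x + (\<Sum>l<m. b i l * v l) + c i"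
    using assms unfolding affine_fun_def by metis
  then show ?thesis
    unfolding soc_system_def
    by (intro exI[of _ 1] exI[of _ "\<lambda>_. d"] exI[of _ "\<lambda>_. a"] exI[of _ "\<lambda>_. b"] exI[of _ "\<lambda>_. c"])
      (simp add: affine_map_def)
qed

lemma soc_system_True: "soc_system m (\<lambda>x v. True)"
  unfolding soc_system_def by (intro exI[of _ 0]) simp

text \<open>The cone blocks of \<open>Q\<close> are appended to those of \<open>P\<close>: block
  \<open>q + k\<close> of the combined map is block \<open>k\<close> of the second.\<close>

lemma soc_system_conj:
  assumes "soc_system m P" "soc_system m Q"
  shows "soc_system m (\<lambda>x v. P x v \<and> Q x v)"
proof -
  obtain q d a B c q' d' a' B' c' where
    P: "\<And>x v. P x v \<longleftrightarrow> (\<forall>k<q. affine_map m a B c x v k \<in> lorentz_cone (d k))" and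
    Q: "\<And>x v. Q x v \<longleftrightarrow> (\<forall>k<q'. affine_map m a' B' c' x v k \<in> lorentz_cone (d' k))"
    using assms unfolding soc_system_def by metis
  let ?d = "\<lambda>k. if k < q then d k else d' (k - q)"
  let ?a = "\<lambda>k. if k < q then a k else a' (k - q)"
  let ?B = "\<lambda>k. if k < q then B k else B' (k - q)"
  let ?c = "\<lambda>k. if k < q then c k else c' (k - q)"
  have split: "(\<forall>k<q + q'. R k) \<longleftrightarrow> (\<forall>k<q. R k) \<and> (\<forall>k<q'. R (q + k))" for R
    by (metis add_less_cancel_left le_add_diff_inverse not_less trans_less_add1)
  have "P x v \<and> Q x v \<longleftrightarrow>
      (\<forall>k<q + q'. affine_map m ?a ?B ?c x v k \<in> lorentz_cone (?d k))" for x v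
    by (simp add: split P Q affine_map_def)
  then show ?thesis
    unfolding soc_system_def
    by (intro exI[of _ "q + q'"] exI[of _ ?d] exI[of _ ?a] exI[of _ ?B] exI[of _ ?c]) blast
qed

lemma soc_system_ball:
  assumes "finite K" "\<And>k. k \<in> K \<Longrightarrow> soc_system m (P k)"
  shows "soc_system m (\<lambda>x v. \<forall>k\<in>K. P k x v)"
  using assms by (induction K) (simp_all add: soc_system_True soc_system_conj)

text \<open>The Lorentz cone with \<open>d = 0\<close> is a half-line: the norm over the empty index
  set \<open>{1..0}\<close> is 0, which leaves \<open>0 \<le> h x v - g x v\<close>.\<close>

lemma soc_system_le:
  assumes "affine_fun m g" "affine_fun m h"
  shows "soc_system m (\<lambda>x v. g x v \<le> h x v)"
  using soc_system_lorentz[of m "\<lambda>_ x v. h x v - g x v" 0] affine_fun_diff[OF assms(2,1)]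
  by (simp add: lorentz_cone_def)

lemma soc_system_eq:
  assumes "affine_fun m g" "affine_fun m h"
  shows "soc_system m (\<lambda>x v. g x v = h x v)"
  using soc_system_conj[OF soc_system_le[OF assms] soc_system_le[OF assms(2,1)]]
  by (simp add: order_eq_iff)

text \<open>The rotated cone, via \<open>4 r s = (r + s)\<^sup>2 - (r - s)\<^sup>2\<close>.\<close>

lemma soc_system_rotated:
  assumes "affine_fun m t" "affine_fun m r" "affine_fun m s"
  shows "soc_system m (\<lambda>x v. 0 \<le> r x v \<and> 0 \<le> s x v \<and> (t x v)\<^sup>2 \<le> r x v * s x v)"
proof -
  let ?g = "\<lambda>i x v. if i = 0 then r x v + s x v else if i = 1 then 2 * t x v else r x v - s x v"
  have "affine_fun m (?g i)" for i :: nat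
    using assms by (cases "i = 0"; cases "i = 1") (auto intro!: affine_fun_intros)
  then have soc: "soc_system m (\<lambda>x v. (\<lambda>i. ?g i x v) \<in> lorentz_cone 2)"
    by (rule soc_system_lorentz)
  have "(\<lambda>i. ?g i x v) \<in> lorentz_cone 2 \<longleftrightarrow>
      0 \<le> r x v \<and> 0 \<le> s x v \<and> (t x v)\<^sup>2 \<le> r x v * s x v" (is "?L \<longleftrightarrow> ?R") for x v
  proof -
    have "{1..2::nat} = {1, 2}"
      by auto
    then have "?L \<longleftrightarrow> sqrt ((2 * t x v)\<^sup>2 + (r x v - s x v)\<^sup>2) \<le> r x v + s x v"
      by (simp add: lorentz_cone_def L2_set_def)
    also have "\<dots> \<longleftrightarrow> 0 \<le> r x v + s x v \<and> (2 * t x v)\<^sup>2 + (r x v - s x v)\<^sup>2 \<le> (r x v + s x v)\<^sup>2"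
      by (meson order_trans real_le_lsqrt real_sqrt_ge_zero sqrt_le_D sum_power2_ge_zero)
    also have "\<dots> \<longleftrightarrow> 0 \<le> r x v + s x v \<and> (t x v)\<^sup>2 \<le> r x v * s x v"
      by (simp add: power2_eq_square algebra_simps)
    also have "\<dots> \<longleftrightarrow> ?R"
    proof -
      \<comment> \<open>A nonnegative product means equal signs; together with
        \<open>0 \<le> r + s\<close> this makes both factors nonnegative.\<close>
      have "0 \<le> r x v * s x v" if "(t x v)\<^sup>2 \<le> r x v * s x v"
        using that zero_le_power2 order_trans by blast
      then show ?thesis
        by (auto simp: zero_le_mult_iff)
    qed
    finally show ?thesis .
  qed
  with soc show ?thesis
    by simp
qed

text \<open>Minkowski's inequality. The weights need not sum to 1, since the set is a convex
  cone.\<close>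

lemma convex_lorentz_cone:
  assumes "y \<in> lorentz_cone d" "z \<in> lorentz_cone d" "0 \<le> s" "0 \<le> t"
  shows "(\<lambda>i. s * y i + t * z i) \<in> lorentz_cone d"
proof -
  have "L2_set (\<lambda>i. s * y i + t * z i) {1..d} \<le> s * L2_set y {1..d} + t * L2_set z {1..d}"
    using L2_set_triangle_ineq[of "\<lambda>i. s * y i" "\<lambda>i. t * z i"] assms(3,4)
    by (simp add: L2_set_right_distrib)
  also have "\<dots> \<le> s * y 0 + t * z 0"
    using assms unfolding lorentz_cone_def by (intro add_mono mult_left_mono) auto
  finally show ?thesis
    by (simp add: lorentz_cone_def)
qed

text \<open>Convexity comes with the representation: affine maps commute with convex combinations,
  so combining the witnesses \<open>v\<close> and \<open>v'\<close> gives a witness for the combined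
  point.\<close>

lemma SOCr_soc_system:
  fixes P :: "'a::euclidean_space \<Rightarrow> (nat \<Rightarrow> real) \<Rightarrow> bool"
  assumes "soc_system m P"
  shows "SOCr {x. \<exists>v. P x v}"
proof -
  obtain q d a B c where
    P: "\<And>x v. P x v \<longleftrightarrow> (\<forall>k<q. affine_map m a B c x v k \<in> lorentz_cone (d k))"
    using assms unfolding soc_system_def by metis
  have "convex {x. \<exists>v. P x v}"
  proof (rule convexI)
    fix x y s t
    assume "x \<in> {x. \<exists>v. P x v}" "y \<in> {x. \<exists>v. P x v}" and st: "0 \<le> s" "0 \<le> t" "s + t = (1::real)"
    then obtain v v' where v: "P x v" "P y v'"
      by blast
    let ?z = "s *\<^sub>R x + t *\<^sub>R y" and ?v = "\<lambda>l. s * v l + t * v' l"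
    have "affine_map m a B c ?z ?v k =
        (\<lambda>i. s * affine_map m a B c x v k i + t * affine_map m a B c y v' k i)" for k
    proof
      fix i
      \<comment> \<open>Only the constant term depends on the weights summing to 1.\<close>
      have "c k i = s * c k i + t * c k i"
        using st(3) by (metis distrib_right mult_1)
      then show "affine_map m a B c ?z ?v k i =
          s * affine_map m a B c x v k i + t * affine_map m a B c y v' k i"
        unfolding affine_map_def
        by (simp add: inner_add_right sum.distrib sum_distrib_left algebra_simps)
    qed
    then have "P ?z ?v"
      using v st convex_lorentz_cone unfolding P by simp
    then show "?z \<in> {x. \<exists>v. P x v}"
      by blast
  qed
  moreover have "{x. \<exists>v. P x v} =
      {x. \<exists>v. affine_map m a B c x v \<in> (\<Pi> k\<in>{..<q}. lorentz_cone (d k))}"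
    by (simp add: P Pi_def)
  ultimately show ?thesis
    unfolding SOCr_def by blast
qed

section \<open>Convex hulls of quadratic arcs\<close>

definition quad_arc :: "'a::real_vector \<Rightarrow> 'a \<Rightarrow> 'a \<Rightarrow> real \<Rightarrow> 'a" where
  "quad_arc c u v t = c + t *\<^sub>R u + t\<^sup>2 *\<^sub>R v"

text \<open>In the plane, \<open>(t, r)\<close> lies between the parabola and its chord over
  \<open>[a, b]\<close>, hence on a segment from the left endpoint to another point of the parabola
  arc. The affine map sending \<open>(t, r)\<close> to \<open>c + t u + r v\<close> carries this
  combination over.\<close>

lemma quad_arc_hull_memI:
  assumes "a \<le> t" "t\<^sup>2 \<le> r" "r \<le> (a + b) * t - a * b" "t \<le> b"
  shows "c + t *\<^sub>R u + r *\<^sub>R v \<in> convex hull (quad_arc c u v ` {a..b})"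
proof (cases "t = a")
  case True
  then have "r = t\<^sup>2"
    using assms by (simp add: power2_eq_square algebra_simps)
  then show ?thesis
    using assms by (intro hull_inc image_eqI[of _ _ t]) (auto simp: quad_arc_def)
next
  case False
  then have ta: "a < t"
    using assms by simp
  text \<open>The line through \<open>(a, a\<^sup>2)\<close> and \<open>(t, r)\<close> meets the parabola again at \<open>t'\<close>.\<close>
  define t' where "t' = (r - a\<^sup>2) / (t - a) - a"
  define \<mu> where "\<mu> = (t - a) / (t' - a)"
  have slope: "(t' + a) * (t - a) = r - a\<^sup>2"
    using ta by (simp add: t'_def)
  \<comment> \<open>The secant slope \<open>t' + a\<close> is at least \<open>t + a\<close> because
    \<open>t^2 \<le> r\<close>, and at most \<open>b + a\<close> by the chord bound.\<close>
  have "(t + a) * (t - a) \<le> (t' + a) * (t - a)" "(t' + a) * (t - a) \<le> (b + a) * (t - a)"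
    using assms slope by (simp_all add: power2_eq_square algebra_simps)
  then have t': "t \<le> t'" "t' \<le> b"
    using ta by (simp_all add: mult_le_cancel_right)
  then have \<mu>: "0 \<le> \<mu>" "\<mu> \<le> 1" "\<mu> * (t' - a) = t - a"
    using ta by (simp_all add: \<mu>_def)
  have t: "(1 - \<mu>) * a + \<mu> * t' = t"
    using \<mu>(3) by (simp add: algebra_simps)
  have "(1 - \<mu>) * a\<^sup>2 + \<mu> * t'\<^sup>2 = a\<^sup>2 + (t' + a) * (\<mu> * (t' - a))"
    by (simp add: power2_eq_square algebra_simps)
  then have r: "(1 - \<mu>) * a\<^sup>2 + \<mu> * t'\<^sup>2 = r"
    using \<mu>(3) slope by simp
  have "(1 - \<mu>) *\<^sub>R quad_arc c u v a + \<mu> *\<^sub>R quad_arc c u v t' \<in> convex hull (quad_arc c u v ` {a..b})"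
    using assms t' ta \<mu> by (intro convexD[OF convex_convex_hull] hull_inc) auto
  also have "(1 - \<mu>) *\<^sub>R quad_arc c u v a + \<mu> *\<^sub>R quad_arc c u v t' =
      c + ((1 - \<mu>) * a + \<mu> * t') *\<^sub>R u + ((1 - \<mu>) * a\<^sup>2 + \<mu> * t'\<^sup>2) *\<^sub>R v"
    by (simp add: quad_arc_def algebra_simps)
  finally show ?thesis
    by (simp only: t r)
qed

text \<open>The auxiliary coordinates \<open>y (3 * k)\<close>, \<open>y (3 * k + 1)\<close>, \<open>y (3 * k + 2)\<close> are the multiplier of
  arc \<open>k\<close> and its multiples of \<open>t\<close> and of \<open>r\<close>. The bounds on \<open>t\<close> force the multiplier to vanish
  when \<open>{a k..b k}\<close> is empty; the rotated cone together with the chord bound leaves no recession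
  directions for a vanishing multiplier.\<close>

definition arcs_system ::
    "nat \<Rightarrow> (nat \<Rightarrow> 'a::euclidean_space) \<Rightarrow> (nat \<Rightarrow> 'a) \<Rightarrow> (nat \<Rightarrow> 'a) \<Rightarrow> (nat \<Rightarrow> real) \<Rightarrow> (nat \<Rightarrow> real)
      \<Rightarrow> 'a \<Rightarrow> (nat \<Rightarrow> real) \<Rightarrow> bool" where
  "arcs_system n c u v a b x y \<longleftrightarrow>
     (\<Sum>k<n. y (3 * k)) = 1 \<and>
     (\<forall>e\<in>Basis. x \<bullet> e =
        (\<Sum>k<n. y (3 * k) * (c k \<bullet> e) + y (3 * k + 1) * (u k \<bullet> e) + y (3 * k + 2) * (v k \<bullet> e))) \<and>
     (\<forall>k\<in>{..<n}.
        (0 \<le> y (3 * k + 2) \<and> 0 \<le> y (3 * k) \<and> (y (3 * k + 1))\<^sup>2 \<le> y (3 * k + 2) * y (3 * k)) \<and>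
        a k * y (3 * k) \<le> y (3 * k + 1) \<and> y (3 * k + 1) \<le> b k * y (3 * k) \<and>
        y (3 * k + 2) \<le> (a k + b k) * y (3 * k + 1) - a k * b k * y (3 * k))"

lemma soc_system_arcs_system: "soc_system (3 * n) (arcs_system n c u v a b)"
  unfolding arcs_system_def
  by (intro soc_system_conj soc_system_ball soc_system_eq soc_system_le soc_system_rotated
      affine_fun_intros) auto

text \<open>Dividing block \<open>k\<close> by its positive multiplier recovers the unhomogenised
  constraints, so \<open>x\<close> is a convex combination of points \<open>z k\<close>, each in the
  hull of its own arc.\<close>

lemma arcs_system_imp_hull:
  assumes "arcs_system n c u v a b x y"
  shows "x \<in> convex hull (\<Union>k<n. quad_arc (c k) (u k) (v k) ` {a k..b k})" (is "_ \<in> convex hull ?A")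
proof -
  have sum1: "(\<Sum>k<n. y (3 * k)) = 1"
    and ball: "\<And>k. k < n \<Longrightarrow>
        0 \<le> y (3 * k + 2) \<and> 0 \<le> y (3 * k) \<and> (y (3 * k + 1))\<^sup>2 \<le> y (3 * k + 2) * y (3 * k) \<and>
        a k * y (3 * k) \<le> y (3 * k + 1) \<and> y (3 * k + 1) \<le> b k * y (3 * k) \<and>
        y (3 * k + 2) \<le> (a k + b k) * y (3 * k + 1) - a k * b k * y (3 * k)"
    and x: "\<And>e. e \<in> Basis \<Longrightarrow> x \<bullet> e =
        (\<Sum>k<n. y (3 * k) * (c k \<bullet> e) + y (3 * k + 1) * (u k \<bullet> e) + y (3 * k + 2) * (v k \<bullet> e))"
    using assms unfolding arcs_system_def by auto
  define K where "K = {k \<in> {..<n}. y (3 * k) \<noteq> 0}"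
  define z where
    "z k = c k + (y (3 * k + 1) / y (3 * k)) *\<^sub>R u k + (y (3 * k + 2) / y (3 * k)) *\<^sub>R v k" for k
  have "x = (\<Sum>k<n. y (3 * k) *\<^sub>R c k + y (3 * k + 1) *\<^sub>R u k + y (3 * k + 2) *\<^sub>R v k)"
    by (rule euclidean_eqI) (simp add: x inner_sum_left inner_add_left)
  also have "\<dots> = (\<Sum>k<n. y (3 * k) *\<^sub>R z k)"
  proof (rule sum.cong)
    fix k assume "k \<in> {..<n}"
    \<comment> \<open>With multiplier 0 the rotated cone forces \<open>y (3 * k + 1) = 0\<close>;
      the chord bound then gives \<open>y (3 * k + 2) \<le> 0\<close>, so this coordinate vanishes
      as well.\<close>
    then have "y (3 * k) = 0 \<Longrightarrow> y (3 * k + 1) = 0 \<and> y (3 * k + 2) = 0"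
      using ball[of k] by auto
    then show "y (3 * k) *\<^sub>R c k + y (3 * k + 1) *\<^sub>R u k + y (3 * k + 2) *\<^sub>R v k = y (3 * k) *\<^sub>R z k"
      by (cases "y (3 * k) = 0") (auto simp: z_def scaleR_add_right)
  qed simp
  also have "\<dots> = (\<Sum>k\<in>K. y (3 * k) *\<^sub>R z k)"
    by (rule sum.mono_neutral_right) (auto simp: K_def)
  also have "\<dots> \<in> convex hull ?A"
  proof (rule convex_sum)
    have "(\<Sum>k\<in>K. y (3 * k)) = (\<Sum>k<n. y (3 * k))"
      by (rule sum.mono_neutral_left) (auto simp: K_def)
    then show "(\<Sum>k\<in>K. y (3 * k)) = 1"
      using sum1 by simp
  next
    fix k assume "k \<in> K"
    then have k: "k < n" "y (3 * k) > 0"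
      using ball[of k] by (auto simp: K_def)
    let ?t = "y (3 * k + 1) / y (3 * k)" and ?r = "y (3 * k + 2) / y (3 * k)"
    have "a k \<le> ?t" "?t \<le> b k" "?t\<^sup>2 \<le> ?r" "?r \<le> (a k + b k) * ?t - a k * b k"
      using ball[OF k(1)] k(2) by (auto simp: field_simps power2_eq_square)
    then have "z k \<in> convex hull (quad_arc (c k) (u k) (v k) ` {a k..b k})"
      unfolding z_def by (intro quad_arc_hull_memI)
    also have "\<dots> \<subseteq> convex hull ?A"
      using k(1) by (intro hull_mono) auto
    finally show "z k \<in> convex hull ?A" .
  qed (use ball in \<open>auto simp: K_def\<close>)
  finally show ?thesis .
qed

text \<open>Arc \<open>k\<close> receives multiplier 1 and all other blocks are zero, which
  satisfies their homogeneous constraints even where the parameter interval is empty.\<close>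

lemma arc_imp_arcs_system:
  assumes "k < n" "t \<in> {a k..b k}"
  shows "\<exists>y. arcs_system n c u v a b (quad_arc (c k) (u k) (v k) t) y"
proof -
  define y :: "nat \<Rightarrow> real" where
    "y l = (if l = 3 * k then 1 else if l = 3 * k + 1 then t else if l = 3 * k + 2 then t\<^sup>2 else 0)"
    for l
  \<comment> \<open>The three kinds of index lie in distinct residue classes modulo 3, so the cases
    cannot collide.\<close>
  have y: "y (3 * l) = (if l = k then 1 else 0)" "y (3 * l + 1) = (if l = k then t else 0)"
    "y (3 * l + 2) = (if l = k then t\<^sup>2 else 0)" for l
    unfolding y_def by (auto; presburger)+
  have chord: "t\<^sup>2 \<le> (a k + b k) * t - a k * b k"
    using mult_nonneg_nonneg[of "t - a k" "b k - t"] assms(2)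
    by (simp add: power2_eq_square algebra_simps)
  have "(\<Sum>l<n. y (3 * l) * (c l \<bullet> e) + y (3 * l + 1) * (u l \<bullet> e) + y (3 * l + 2) * (v l \<bullet> e)) =
      (\<Sum>l<n. if l = k then quad_arc (c k) (u k) (v k) t \<bullet> e else 0)" for e
    unfolding y by (rule sum.cong) (auto simp: quad_arc_def inner_add_left)
  then have "arcs_system n c u v a b (quad_arc (c k) (u k) (v k) t) y"
    unfolding arcs_system_def
    using assms chord by (simp add: y[simplified])
  then show ?thesis
    by blast
qed

lemma SOCr_convex_hull_arcs:
  fixes c u v :: "nat \<Rightarrow> 'a::euclidean_space"
  shows "SOCr (convex hull (\<Union>k<n. quad_arc (c k) (u k) (v k) ` {a k..b k}))" (is "SOCr (convex hull ?A)")
proof -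
  let ?Y = "{x. \<exists>y. arcs_system n c u v a b x y}"
  have SOCr: "SOCr ?Y"
    by (rule SOCr_soc_system[OF soc_system_arcs_system])
  \<comment> \<open>As \<open>?Y\<close> is convex, it suffices to represent the points of single
    arcs.\<close>
  have "convex hull ?A \<subseteq> ?Y"
  proof (rule hull_minimal)
    show "?A \<subseteq> ?Y"
      using arc_imp_arcs_system by fast
    show "convex ?Y"
      using SOCr by (simp add: SOCr_def)
  qed
  moreover have "?Y \<subseteq> convex hull ?A"
    using arcs_system_imp_hull by fast
  ultimately have "convex hull ?A = ?Y"
    by (rule equalityI)
  then show ?thesis
    using SOCr by simp
qed

corollary SOCr_convex_hull_Union_arcs:
  fixes F :: "'a::euclidean_space set set"
  assumes "finite F" and "\<And>S. S \<in> F \<Longrightarrow> \<exists>c u v a b. S = quad_arc c u v ` {a..b}"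
  shows "SOCr (convex hull (\<Union>F))"
proof -
  obtain n :: nat and f where F: "F = f ` {i. i < n}"
    using finite_imp_nat_seg_image_inj_on[OF assms(1)] by blast
  have "\<forall>k\<in>{..<n}. \<exists>c u v a b. f k = quad_arc c u v ` {a..b}"
    using assms(2) F by blast
  then obtain c u v a b where "\<forall>k\<in>{..<n}. f k = quad_arc (c k) (u k) (v k) ` {a k..b k}"
    by metis
  then have "\<Union>F = (\<Union>k<n. quad_arc (c k) (u k) (v k) ` {a k..b k})"
    using F by (auto simp: lessThan_def)
  then show ?thesis
    using SOCr_convex_hull_arcs by metis
qed

section \<open>The Weymouth set\<close>

text \<open>Multiplication by a constant of either sign is monotone or antitone, so a bound at both
  ends persists in between.\<close>

lemma mult_between:
  fixes d x t y :: real
  assumes "x \<le> t" "t \<le> y"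
  shows "l \<le> d * x \<Longrightarrow> l \<le> d * y \<Longrightarrow> l \<le> d * t"
    and "d * x \<le> l \<Longrightarrow> d * y \<le> l \<Longrightarrow> d * t \<le> l"
proof -
  have "d * x \<le> d * t \<and> d * t \<le> d * y \<or> d * y \<le> d * t \<and> d * t \<le> d * x"
    using assms by (cases "0 \<le> d") (simp_all add: mult_left_mono mult_left_mono_neg)
  then show "l \<le> d * x \<Longrightarrow> l \<le> d * y \<Longrightarrow> l \<le> d * t"
    and "d * x \<le> l \<Longrightarrow> d * y \<le> l \<Longrightarrow> d * t \<le> l"
    by linarith+
qed

text \<open>The admissible parameters form a closed set, bounded because the flow is, and convex
  because each constraint bounds a multiple of \<open>t\<close> or of \<open>t^2\<close>, both
  monotone for \<open>t \<ge> 0\<close>. An empty set is covered by \<open>b < a\<close>.\<close>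

lemma arc_in_bound_set_interval:
  assumes "\<sigma> \<in> {1, -1 :: real}"
  shows "\<exists>a b. {t. 0 \<le> t \<and> quad_arc (0, c, c) (\<sigma>, 0, 0) (0, d, d') t \<in> bound_set w fl fu pil piu pjl pju} =
    {a..b}" (is "\<exists>a b. ?T = {a..b}")
proof -
  have T: "?T = {t. 0 \<le> t \<and>
      alpha_lo w fl pil pju \<le> \<sigma> * t \<and> \<sigma> * t \<le> alpha_up w fu piu pjl \<and>
      beta_lo w fl pil pju \<le> (d - d') * t\<^sup>2 \<and> (d - d') * t\<^sup>2 \<le> beta_up w fu piu pjl \<and>
      pil - c \<le> d * t\<^sup>2 \<and> d * t\<^sup>2 \<le> piu - c \<and> pjl - c \<le> d' * t\<^sup>2 \<and> d' * t\<^sup>2 \<le> pju - c}"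
    by (auto simp: quad_arc_def bound_set_def algebra_simps)
  have "closed ?T"
    unfolding T by (intro closed_Collect_conj closed_Collect_le continuous_intros)
  moreover have "?T \<subseteq> {0..\<bar>alpha_lo w fl pil pju\<bar> + \<bar>alpha_up w fu piu pjl\<bar>}"
  proof
    fix t assume "t \<in> ?T"
    then have t: "0 \<le> t" "alpha_lo w fl pil pju \<le> \<sigma> * t" "\<sigma> * t \<le> alpha_up w fu piu pjl"
      unfolding T by blast+
    have "\<sigma> = 1 \<or> \<sigma> = -1"
      using assms by simp
    then have "t \<le> \<bar>alpha_lo w fl pil pju\<bar> + \<bar>alpha_up w fu piu pjl\<bar>"
      using t by (elim disjE; hypsubst) linarith+
    then show "t \<in> {0..\<bar>alpha_lo w fl pil pju\<bar> + \<bar>alpha_up w fu piu pjl\<bar>}"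
      using t(1) by simp
  qed
  then have "bounded ?T"
    by (rule bounded_subset[OF bounded_closed_interval])
  moreover have "is_interval ?T"
    unfolding is_interval_1
  proof (intro ballI allI impI, elim conjE)
    fix x y t assume xy: "x \<in> ?T" "y \<in> ?T" and t: "x \<le> t" "t \<le> y"
    have x: "0 \<le> x"
      using xy by simp
    then have "x\<^sup>2 \<le> t\<^sup>2" "t\<^sup>2 \<le> y\<^sup>2"
      using t by (simp_all add: power_mono)
    \<comment> \<open>The first instance handles the flow bounds, the second, applied to squares,
      the pressure bounds.\<close>
    note between = mult_between[OF t] mult_between[OF this]
    show "t \<in> ?T"
      using xy order_trans[OF x t(1)] unfolding T mem_Collect_eq by (blast intro: between)
  qed
  ultimately show ?thesis
    using connected_compact_interval_1[of ?T] by (simp add: compact_eq_bounded_closed is_interval_connected_1)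
qed

text \<open>Where \<open>0 \<le> \<sigma> * f\<close>, the parameter \<open>t = \<sigma> * f\<close>
  turns the equation into \<open>p - q = \<sigma> * w * t^2\<close>. With one pressure fixed at
  \<open>c\<close>, the other is \<open>c\<close> plus a multiple of \<open>t^2\<close>;
  \<open>d\<close> and \<open>d'\<close> are the two coefficients, so both cases share one
  curve.\<close>

lemma weymouth_part_eq_arc:
  assumes "\<sigma> \<in> {1, -1 :: real}"
    and S: "S = {(f, p, q). (f, p, q) \<in> weymouth_set w fl fu pil piu pjl pju \<and> 0 \<le> \<sigma> * f \<and> p = c} \<and>
        d = 0 \<and> d' = - \<sigma> * w \<or>
      S = {(f, p, q). (f, p, q) \<in> weymouth_set w fl fu pil piu pjl pju \<and> 0 \<le> \<sigma> * f \<and> q = c} \<and>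
        d = \<sigma> * w \<and> d' = 0"
  shows "\<exists>c u v a b. S = quad_arc c u v ` {a..b}"
proof -
  let ?\<gamma> = "quad_arc (0, c, c) (\<sigma>, 0, 0) (0, d, d')"
  obtain a b where ab: "{t. 0 \<le> t \<and> ?\<gamma> t \<in> bound_set w fl fu pil piu pjl pju} = {a..b}"
    using arc_in_bound_set_interval[OF assms(1)] by blast
  have "S = ?\<gamma> ` {t. 0 \<le> t \<and> ?\<gamma> t \<in> bound_set w fl fu pil piu pjl pju}"
  proof (intro equalityI subsetI)
    fix z assume "z \<in> S"
    moreover obtain f p q where z: "z = (f, p, q)"
      by (cases z)
    ultimately have "z = ?\<gamma> (\<sigma> * f) \<and> 0 \<le> \<sigma> * f \<and> z \<in> bound_set w fl fu pil piu pjl pju"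
      using assms by (auto simp: quad_arc_def weymouth_set_def power2_eq_square abs_if algebra_simps split: if_splits)
    then show "z \<in> ?\<gamma> ` {t. 0 \<le> t \<and> ?\<gamma> t \<in> bound_set w fl fu pil piu pjl pju}"
      by blast
  next
    fix z assume "z \<in> ?\<gamma> ` {t. 0 \<le> t \<and> ?\<gamma> t \<in> bound_set w fl fu pil piu pjl pju}"
    then show "z \<in> S"
      using assms by (auto simp: quad_arc_def weymouth_set_def power2_eq_square abs_if)
  qed
  then show ?thesis
    unfolding ab by blast
qed

section \<open>Reduction to points with an active pressure bound\<close>

definition weymouth_arcs ::
    "real \<Rightarrow> real \<Rightarrow> real \<Rightarrow> real \<Rightarrow> real \<Rightarrow> real \<Rightarrow> real \<Rightarrow> (real \<times> real \<times> real) set set" where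
  "weymouth_arcs w fl fu pil piu pjl pju =
     (\<lambda>(\<sigma>, c). {(f, p, q). (f, p, q) \<in> weymouth_set w fl fu pil piu pjl pju \<and> 0 \<le> \<sigma> * f \<and> p = c})
       ` ({1, -1} \<times> {pil, piu}) \<union>
     (\<lambda>(\<sigma>, c). {(f, p, q). (f, p, q) \<in> weymouth_set w fl fu pil piu pjl pju \<and> 0 \<le> \<sigma> * f \<and> q = c})
       ` ({1, -1} \<times> {pjl, pju})"

lemma Union_weymouth_arcs:
  "\<Union>(weymouth_arcs w fl fu pil piu pjl pju) =
    {(f, p, q). (f, p, q) \<in> weymouth_set w fl fu pil piu pjl pju \<and>
      (p = pil \<or> p = piu \<or> q = pjl \<or> q = pju)}"
  unfolding weymouth_arcs_def by (auto simp: linorder_le_cases)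

lemma convex_hull_weymouth_set:
  "convex hull (weymouth_set w fl fu pil piu pjl pju) =
    convex hull (\<Union>(weymouth_arcs w fl fu pil piu pjl pju))" (is "convex hull ?X = convex hull ?A")
proof (rule antisym)
  show "convex hull ?A \<subseteq> convex hull ?X"
    by (rule hull_mono) (auto simp: Union_weymouth_arcs)
next
  have "z \<in> convex hull ?A" if zX: "z \<in> ?X" for z
  proof -
    obtain f p q where z: "z = (f, p, q)"
      by (cases z)
    have bounds: "pil \<le> p" "p \<le> piu" "pjl \<le> q" "q \<le> pju"
      using zX by (auto simp: z weymouth_set_def bound_set_def)
    \<comment> \<open>\<open>r\<close> and \<open>s\<close> are the largest common shifts of both
      pressures, down and up, that respect the pressure bounds.\<close>
    define r where "r = min (p - pil) (q - pjl)"
    define s where "s = min (piu - p) (pju - q)"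
    have rs: "0 \<le> r" "0 \<le> s"
      using bounds by (simp_all add: r_def s_def)
    \<comment> \<open>The shifts keep \<open>f\<close> and \<open>p - q\<close>, hence the Weymouth
      equation and the other bounds; a minimum is attained, so a pressure bound becomes
      tight.\<close>
    have lo: "(f, p - r, q - r) \<in> ?A" and up: "(f, p + s, q + s) \<in> ?A"
      using zX bounds unfolding Union_weymouth_arcs r_def s_def z weymouth_set_def bound_set_def
      by (auto simp: min_def)
    show ?thesis
    proof (cases "r + s = 0")
      case True
      then have "r = 0"
        using rs by simp
      then show ?thesis
        using hull_inc[OF lo] by (simp add: z)
    next
      case False
      \<comment> \<open>The weight of the lower endpoint, chosen so that the shifts cancel:
        \<open>(1 - \<mu>) * s = \<mu> * r\<close>.\<close>
      define \<mu> where "\<mu> = s / (r + s)"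
      have \<mu>: "0 \<le> \<mu>" "\<mu> \<le> 1" "\<mu> * (r + s) = s"
        using rs False by (auto simp: \<mu>_def)
      have "\<mu> *\<^sub>R (f, p - r, q - r) + (1 - \<mu>) *\<^sub>R (f, p + s, q + s) \<in> convex hull ?A"
        using lo up \<mu> by (intro convexD[OF convex_convex_hull] hull_inc) auto
      also have "\<mu> *\<^sub>R (f, p - r, q - r) + (1 - \<mu>) *\<^sub>R (f, p + s, q + s) = z"
        using \<mu>(3) by (simp add: z algebra_simps)
      finally show ?thesis .
    qed
  qed
  then show "convex hull ?X \<subseteq> convex hull ?A"
    by (intro hull_minimal subsetI) auto
qed

theorem theorem1:
  fixes w fl fu pil piu pjl pju :: real
  assumes "0 \<le> w"
    and "fl \<le> fu"
    and "0 \<le> pil" and "pil \<le> piu"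
    and "0 \<le> pjl" and "pjl \<le> pju"
    and "alpha_lo w fl pil pju \<le> 0" and "0 \<le> alpha_up w fu piu pjl"
    and "beta_lo w fl pil pju \<le> 0" and "0 \<le> beta_up w fu piu pjl"
  shows "SOCr (convex hull (weymouth_set w fl fu pil piu pjl pju))"
  unfolding convex_hull_weymouth_set
proof (rule SOCr_convex_hull_Union_arcs)
  show "finite (weymouth_arcs w fl fu pil piu pjl pju)"
    by (simp add: weymouth_arcs_def)
next
  fix S assume "S \<in> weymouth_arcs w fl fu pil piu pjl pju"
  then obtain \<sigma> c d d' where "\<sigma> \<in> {1, -1 :: real}"
    "S = {(f, p, q). (f, p, q) \<in> weymouth_set w fl fu pil piu pjl pju \<and> 0 \<le> \<sigma> * f \<and> p = c} \<and>
        d = 0 \<and> d' = - \<sigma> * w \<or>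
      S = {(f, p, q). (f, p, q) \<in> weymouth_set w fl fu pil piu pjl pju \<and> 0 \<le> \<sigma> * f \<and> q = c} \<and>
        d = \<sigma> * w \<and> d' = 0"
    unfolding weymouth_arcs_def by blast
  then show "\<exists>c u v a b. S = quad_arc c u v ` {a..b}"
    by (rule weymouth_part_eq_arc)
qed

end
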